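(* If $\gamma\in(0,1/L_f)$ then $$\inf F=\inf F^{\mathrm{DR}}_\gamma,\qquad \arg\min F=P_\gamma\bigl(\arg\min F^{\mathrm{DR}}_\gamma\bigr).$$
   Context: Let $f:\mathbb{R}^n\to\mathbb{R}$ be convex and twice continuously differentiable with $L_f$-Lipschitz continuous gradient. Let $g:\mathbb{R}^n\to\mathbb{R}\cup\{+\infty\}$ be proper, closed and convex. Put $F=f+g$ and assume that the set of minimizers of $F$ is nonempty. For $\gamma>0$ and a proper closed convex function $h$, $\mathrm{prox}_{\gamma h}(x)=\arg\min_z\{h(z)+\tfrac{1}{2\gamma}\|z-x\|^2\}$ and $h^\gamma(x)=\inf_z\{h(z)+\tfrac{1}{2\gamma}\|z-x\|^2\}$ (the Moreau envelope, which is differentiable). Define $P_\gamma(x)=\mathrm{prox}_{\gamma f}(x)$. The Douglas-Rachford envelope is $$F^{\mathrm{DR}}_\gamma(x)=f^\gamma(x)-\gamma\|\nabla f^\gamma(x)\|^2+g^\gamma\bigl(x-2\gamma\nabla f^\gamma(x)\bigr),\quad x\in\mathbb{R}^n.$$ Here $P_\gamma(S)=\{P_\gamma(x):x\in S\}$ for a set $S$. Convention: $1/L_f=+\infty$ if $L_f=0$. *)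

theory Defs
  imports "HOL-Analysis.Analysis"
begin

definition grad :: "('a::euclidean_space \<Rightarrow> real) \<Rightarrow> 'a \<Rightarrow> 'a" where
  "grad f x = (THE D. GDERIV f x :> D)"

text \<open>The Hessian enters as the derivative of the gradient; its continuity is with respect to the
  operator norm.\<close>

definition twice_continuously_differentiable :: "('a::euclidean_space \<Rightarrow> real) \<Rightarrow> bool" where
  "twice_continuously_differentiable f \<longleftrightarrow>
     (\<forall>x. f differentiable (at x)) \<and>
     (\<exists>H :: 'a \<Rightarrow> 'a \<Rightarrow>\<^sub>L 'a.
        (\<forall>x. (grad f has_derivative blinfun_apply (H x)) (at x)) \<and> continuous_on UNIV H)"

text \<open>As usual, the epigraph of an extended-real-valued function only has finite second
  components.\<close>

definition epi :: "('a \<Rightarrow> ereal) \<Rightarrow> ('a \<times> real) set" where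
  "epi h = {(x, r). h x \<le> ereal r}"

definition proper_fun :: "('a \<Rightarrow> ereal) \<Rightarrow> bool" where
  "proper_fun h \<longleftrightarrow> (\<forall>x. h x \<noteq> -\<infinity>) \<and> (\<exists>x. h x \<noteq> \<infinity>)"

definition closed_fun :: "('a::topological_space \<Rightarrow> ereal) \<Rightarrow> bool" where
  "closed_fun h \<longleftrightarrow> closed (epi h)"

definition convex_fun :: "('a::real_vector \<Rightarrow> ereal) \<Rightarrow> bool" where
  "convex_fun h \<longleftrightarrow> convex (epi h)"

definition argmin_set :: "('a \<Rightarrow> ereal) \<Rightarrow> 'a set" where
  "argmin_set h = {x. is_arg_min h (\<lambda>_. True) x}"

definition prox_objective :: "real \<Rightarrow> ('a::euclidean_space \<Rightarrow> ereal) \<Rightarrow> 'a \<Rightarrow> 'a \<Rightarrow> ereal" where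
  "prox_objective \<gamma> h x z = h z + ereal (1 / (2 * \<gamma>) * (norm (z - x))\<^sup>2)"

text \<open>For \<open>\<gamma> > 0\<close> and \<open>h\<close> proper, closed and convex the minimizer is unique, so the choice made
  by \<open>arg_min\<close> is immaterial.\<close>

definition prox :: "real \<Rightarrow> ('a::euclidean_space \<Rightarrow> ereal) \<Rightarrow> 'a \<Rightarrow> 'a" where
  "prox \<gamma> h x = arg_min (prox_objective \<gamma> h x) (\<lambda>_. True)"

definition moreau_env :: "real \<Rightarrow> ('a::euclidean_space \<Rightarrow> ereal) \<Rightarrow> 'a \<Rightarrow> ereal" where
  "moreau_env \<gamma> h x = (INF z. prox_objective \<gamma> h x z)"

text \<open>For \<open>\<gamma> > 0\<close> and \<open>h\<close> proper, closed and convex the envelope is finite everywhere, so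
  \<open>real_of_ereal\<close> loses no information.\<close>

definition grad_moreau_env :: "real \<Rightarrow> ('a::euclidean_space \<Rightarrow> ereal) \<Rightarrow> 'a \<Rightarrow> 'a" where
  "grad_moreau_env \<gamma> h = grad (\<lambda>x. real_of_ereal (moreau_env \<gamma> h x))"

definition DR_env ::
  "real \<Rightarrow> ('a::euclidean_space \<Rightarrow> ereal) \<Rightarrow> ('a \<Rightarrow> ereal) \<Rightarrow> 'a \<Rightarrow> ereal" where
  "DR_env \<gamma> f g x =
     moreau_env \<gamma> f x - ereal (\<gamma> * (norm (grad_moreau_env \<gamma> f x))\<^sup>2)
       + moreau_env \<gamma> g (x - (2 * \<gamma>) *\<^sub>R grad_moreau_env \<gamma> f x)"

end

theory Submission
  imports Defs
begin

text \<open>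
  The map \<open>P = prox \<gamma> f\<close> inverts the forward step \<open>p \<mapsto> p + \<gamma> *\<^sub>R grad f p\<close>: this is the optimality
  condition of the proximal problem. In particular \<open>P\<close> is onto. The condition \<open>\<gamma> * L < 1\<close> makes the equation
  \<open>p = x - \<gamma> *\<^sub>R grad f p\<close> a fixed-point problem for a contraction, so every \<open>x\<close> is
  such a forward step (\<open>forward_step_surjective\<close>). Moreover the gradient of the Moreau envelope of \<open>f\<close> at
  \<open>x\<close> is \<open>grad f (P x)\<close> (\<open>grad_moreau_env_eq\<close>). Inserting this in the definition of the
  Douglas-Rachford envelope and completing the square gives
  \<open>DR_env \<gamma> f g x = FB_env \<gamma> f g (P x)\<close> (\<open>DR_env_eq_FB_env\<close>), where \<open>FB_env\<close> is the
  forward-backward envelope: \<open>f\<close> is replaced by its linearization at \<open>p\<close>, a quadratic with coefficient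
  \<open>1 / (2 * \<gamma>)\<close> is added, and the sum with \<open>g\<close> is minimized. As \<open>P\<close> is onto, both
  envelopes have the same infimum, and \<open>P\<close> maps the minimizers of
  \<open>DR_env\<close> onto those of \<open>FB_env\<close>.

  It remains to compare \<open>FB_env\<close> with \<open>F = f + g\<close>. Evaluating the minimized model at \<open>p\<close> itself gives
  \<open>FB_env \<gamma> f g p \<le> F p\<close>. Conversely, by the descent lemma the model at \<open>z\<close> is at least
  \<open>F z + c * (norm (z - p))\<^sup>2\<close> with \<open>c = 1 / (2 * \<gamma>) - L / 2 > 0\<close>. Hence the infima agree. If
  \<open>FB_env \<gamma> f g p\<close> attains the minimum of \<open>F\<close>, then the penalty forces nearly optimal \<open>z\<close> to converge
  to \<open>p\<close>, and lower semicontinuity of \<open>g\<close> shows that \<open>p\<close> minimizes \<open>F\<close>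
  (\<open>FB_env_le_imp_le\<close>).
\<close>

section \<open>Gradients\<close>

lemma grad_eqI:
  assumes "GDERIV f x :> D"
  shows "grad f x = D"
proof -
  have "E = D" if "GDERIV f x :> E" for E
  proof -
    have "(\<lambda>h. inner h E) = (\<lambda>h. inner h D)"
      using that assms unfolding gderiv_def by (rule has_derivative_unique)
    then have "inner (E - D) E = inner (E - D) D"
      by meson
    then show ?thesis
      by (metis inner_diff_right inner_eq_zero_iff right_minus_eq)
  qed
  then show ?thesis
    unfolding grad_def using assms by blast
qed

lemma GDERIV_grad:
  fixes f :: "'a::euclidean_space \<Rightarrow> real"
  assumes "f differentiable (at x)"
  shows "GDERIV f x :> grad f x"
proof -
  obtain f' where f': "(f has_derivative f') (at x)"
    using assms unfolding differentiable_def by blast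
  then have "linear f'"
    by (rule has_derivative_linear)
  then have "f' = (\<lambda>h. inner h (adjoint f' 1))"
    by (simp add: adjoint_works fun_eq_iff)
  then have "GDERIV f x :> adjoint f' 1"
    using f' unfolding gderiv_def by metis
  then show ?thesis
    using grad_eqI by metis
qed

lemma DERIV_along_line:
  fixes f :: "'a::euclidean_space \<Rightarrow> real"
  assumes "f differentiable (at (p + t *\<^sub>R d))"
  shows "((\<lambda>t. f (p + t *\<^sub>R d)) has_real_derivative inner (grad f (p + t *\<^sub>R d)) d) (at t)"
proof -
  have "((\<lambda>t. p + t *\<^sub>R d) has_derivative (\<lambda>s. s *\<^sub>R d)) (at t)"
    by (auto intro!: derivative_eq_intros)
  moreover have "(f has_derivative (\<lambda>h. inner h (grad f (p + t *\<^sub>R d)))) (at (p + t *\<^sub>R d))"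
    using GDERIV_grad[OF assms] by (simp add: gderiv_def)
  ultimately have "((\<lambda>t. f (p + t *\<^sub>R d)) has_derivative
      (\<lambda>s. inner (s *\<^sub>R d) (grad f (p + t *\<^sub>R d)))) (at t)"
    by (rule has_derivative_compose)
  then show ?thesis
    by (simp add: has_field_derivative_def inner_commute mult_commute_abs)
qed

text \<open>Restricting to the line through \<open>p\<close> and \<open>z\<close> reduces this to the tangent inequality for
  convex functions of one real variable.\<close>

lemma convex_above_tangent_plane:
  fixes f :: "'a::euclidean_space \<Rightarrow> real"
  assumes "convex_on UNIV f" and "f differentiable (at p)"
  shows "f p + inner (grad f p) (z - p) \<le> f z"
proof -
  let ?\<phi> = "\<lambda>t::real. f (p + t *\<^sub>R (z - p))"
  have "convex_on UNIV ?\<phi>"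
  proof (rule convex_onI)
    fix t x y :: real
    assume t: "0 < t" "t < 1"
    have "p + ((1 - t) *\<^sub>R x + t *\<^sub>R y) *\<^sub>R (z - p)
        = (1 - t) *\<^sub>R (p + x *\<^sub>R (z - p)) + t *\<^sub>R (p + y *\<^sub>R (z - p))"
      by (simp add: algebra_simps)
    then show "?\<phi> ((1 - t) *\<^sub>R x + t *\<^sub>R y) \<le> (1 - t) * ?\<phi> x + t * ?\<phi> y"
      using convex_onD[OF assms(1), of t] t by simp
  qed simp
  moreover have "(?\<phi> has_real_derivative inner (grad f p) (z - p)) (at 0)"
    using DERIV_along_line[of f p 0 "z - p"] assms(2) by simp
  ultimately have "?\<phi> 1 - ?\<phi> 0 \<ge> inner (grad f p) (z - p) * (1 - 0)"
    by (intro convex_on_imp_above_tangent[of UNIV]) auto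
  then show ?thesis
    by simp
qed

text \<open>On the segment from \<open>p\<close> to \<open>z\<close>, the Lipschitz bound lets the slope of \<open>f\<close> exceed its initial
  value at time \<open>t\<close> by at most \<open>L * t * (norm (z - p))\<^sup>2\<close>, so \<open>f\<close> minus the quadratic upper bound
  is nonincreasing there.\<close>

lemma descent_lemma:
  fixes f :: "'a::euclidean_space \<Rightarrow> real"
  assumes diff: "\<And>x. f differentiable (at x)" and lip: "L-lipschitz_on UNIV (grad f)"
  shows "f z \<le> f p + inner (grad f p) (z - p) + L / 2 * (norm (z - p))\<^sup>2"
proof -
  define d where "d = z - p"
  let ?\<psi> = "\<lambda>t. f (p + t *\<^sub>R d) - t * inner (grad f p) d - L / 2 * t\<^sup>2 * (norm d)\<^sup>2"
  have "?\<psi> 1 \<le> ?\<psi> 0"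
  proof (rule DERIV_nonpos_imp_nonincreasing[of 0 1 ?\<psi>])
    fix t :: real
    assume t: "0 \<le> t" "t \<le> 1"
    have "inner (grad f (p + t *\<^sub>R d) - grad f p) d \<le> norm (grad f (p + t *\<^sub>R d) - grad f p) * norm d"
      by (rule norm_cauchy_schwarz)
    also have "\<dots> \<le> (L * norm (t *\<^sub>R d)) * norm d"
      using lipschitz_on_normD[OF lip, of "p + t *\<^sub>R d" p] by (intro mult_right_mono) auto
    also have "\<dots> = L * t * (norm d)\<^sup>2"
      using t by (simp add: power2_eq_square)
    finally have "inner (grad f (p + t *\<^sub>R d)) d - inner (grad f p) d - L * t * (norm d)\<^sup>2 \<le> 0"
      by (simp add: inner_diff_left)
    moreover have "(?\<psi> has_real_derivative
        inner (grad f (p + t *\<^sub>R d)) d - inner (grad f p) d - L * t * (norm d)\<^sup>2) (at t)"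
      by (auto intro!: derivative_eq_intros DERIV_along_line diff)
    ultimately show "\<exists>y. (?\<psi> has_real_derivative y) (at t) \<and> y \<le> 0"
      by blast
  qed simp
  then show ?thesis
    by (simp add: d_def)
qed

section \<open>The proximal map of a smooth convex function\<close>

text \<open>A preimage of \<open>x\<close> is a fixed point of \<open>\<lambda>p. x - \<gamma> *\<^sub>R grad f p\<close>, which is a contraction with
  constant \<open>\<gamma> * L\<close>.\<close>

lemma forward_step_surjective:
  fixes f :: "'a::euclidean_space \<Rightarrow> real"
  assumes "L-lipschitz_on UNIV (grad f)" and "0 \<le> \<gamma>" and "\<gamma> * L < 1"
  shows "\<exists>p. p + \<gamma> *\<^sub>R grad f p = x"
proof -
  have "dist (x - \<gamma> *\<^sub>R grad f p) (x - \<gamma> *\<^sub>R grad f q) \<le> \<gamma> * L * dist p q" for p q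
  proof -
    have "dist (x - \<gamma> *\<^sub>R grad f p) (x - \<gamma> *\<^sub>R grad f q) = \<gamma> * dist (grad f p) (grad f q)"
      using assms(2) by (simp add: dist_norm norm_minus_commute flip: scaleR_diff_right)
    also have "\<dots> \<le> \<gamma> * (L * dist p q)"
      using lipschitz_onD[OF assms(1), of p q] assms(2) by (intro mult_left_mono) auto
    finally show ?thesis
      by simp
  qed
  then obtain p where "x - \<gamma> *\<^sub>R grad f p = p"
    using banach_fix_type[of "\<gamma> * L" "\<lambda>p. x - \<gamma> *\<^sub>R grad f p"] assms lipschitz_on_nonneg
    by (metis mult_nonneg_nonneg)
  then show ?thesis
    by (metis diff_add_cancel)
qed

context
  fixes f :: "'a::euclidean_space \<Rightarrow> real" and \<gamma> :: real and p x :: 'a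
  assumes convex: "convex_on UNIV f" and diff: "f differentiable (at p)"
    and \<gamma>: "0 < \<gamma>" and x: "p + \<gamma> *\<^sub>R grad f p = x"
begin

text \<open>
  The objective of the proximal map is strongly convex, and \<open>p\<close> is its critical point. The identity
  \<open>x - p = \<gamma> *\<^sub>R grad f p\<close> turns the cross term of the expanded square into exactly the slope of the
  tangent plane of \<open>f\<close> at \<open>p\<close>.
\<close>

lemma prox_objective_growth:
  "f p + 1 / (2 * \<gamma>) * (norm (p - x))\<^sup>2 + 1 / (2 * \<gamma>) * (norm (z - p))\<^sup>2
    \<le> f z + 1 / (2 * \<gamma>) * (norm (z - x))\<^sup>2"
proof -
  have "(norm (z - x))\<^sup>2 = (norm ((z - p) - \<gamma> *\<^sub>R grad f p))\<^sup>2"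
    by (simp add: x[symmetric] algebra_simps)
  also have "\<dots> = (norm (z - p))\<^sup>2 - 2 * \<gamma> * inner (grad f p) (z - p) + (norm (p - x))\<^sup>2"
    unfolding x[symmetric] power2_norm_eq_inner by (simp add: inner_diff inner_commute)
  finally have "1 / (2 * \<gamma>) * (norm (z - x))\<^sup>2 = 1 / (2 * \<gamma>) * (norm (z - p))\<^sup>2
      - inner (grad f p) (z - p) + 1 / (2 * \<gamma>) * (norm (p - x))\<^sup>2"
    using \<gamma> by (simp add: field_simps)
  then show ?thesis
    using convex_above_tangent_plane[OF convex diff, of z] by linarith
qed

lemma prox_objective_minimal:
  "prox_objective \<gamma> (\<lambda>x. ereal (f x)) x p \<le> prox_objective \<gamma> (\<lambda>x. ereal (f x)) x z"
proof -
  have "0 \<le> 1 / (2 * \<gamma>) * (norm (z - p))\<^sup>2"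
    using \<gamma> by simp
  with prox_objective_growth[of z] show ?thesis
    unfolding prox_objective_def plus_ereal.simps ereal_less_eq by linarith
qed

lemma prox_eq:
  "prox \<gamma> (\<lambda>x. ereal (f x)) x = p"
proof -
  let ?obj = "prox_objective \<gamma> (\<lambda>x. ereal (f x)) x"
  have "is_arg_min ?obj (\<lambda>_. True) q \<longleftrightarrow> q = p" for q
  proof
    assume "q = p"
    then show "is_arg_min ?obj (\<lambda>_. True) q"
      using prox_objective_minimal by (simp add: is_arg_min_linorder)
  next
    assume "is_arg_min ?obj (\<lambda>_. True) q"
    then have "?obj q \<le> ?obj p"
      by (simp add: is_arg_min_linorder)
    then have "f q + 1 / (2 * \<gamma>) * (norm (q - x))\<^sup>2 \<le> f p + 1 / (2 * \<gamma>) * (norm (p - x))\<^sup>2"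
      by (simp add: prox_objective_def)
    with prox_objective_growth[of q] have "1 / (2 * \<gamma>) * (norm (q - p))\<^sup>2 \<le> 0"
      by linarith
    then show "q = p"
      using \<gamma> by (simp add: divide_le_0_iff)
  qed
  then have "is_arg_min ?obj (\<lambda>_. True) = (\<lambda>q. q = p)"
    by blast
  then show ?thesis
    unfolding prox_def arg_min_def by simp
qed

lemma moreau_env_eq:
  "moreau_env \<gamma> (\<lambda>x. ereal (f x)) x = ereal (f p + \<gamma> / 2 * (norm (grad f p))\<^sup>2)"
proof -
  let ?obj = "prox_objective \<gamma> (\<lambda>x. ereal (f x)) x"
  have "moreau_env \<gamma> (\<lambda>x. ereal (f x)) x = ?obj p"
    unfolding moreau_env_def using prox_objective_minimal by (intro INF_eqI) auto
  also have "\<dots> = ereal (f p + \<gamma> / 2 * (norm (grad f p))\<^sup>2)"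
    using \<gamma> by (simp add: prox_objective_def x[symmetric] power_mult_distrib power2_eq_square)
  finally show ?thesis .
qed

end

text \<open>
  The envelope \<open>e\<close> is squeezed between its candidate tangent plane at \<open>x\<close> and that plane plus
  \<open>1 / (2 * \<gamma>) * (norm (y - x))\<^sup>2\<close>. The upper bound uses the proximal point \<open>p\<close> of \<open>x\<close> as a competitor
  in the problem that defines \<open>e y\<close>; the lower bound comes from the tangent plane of \<open>f\<close> at \<open>p\<close>,
  evaluated at the proximal point \<open>q\<close> of \<open>y\<close>.
\<close>

lemma grad_moreau_env_eq:
  fixes f :: "'a::euclidean_space \<Rightarrow> real"
  assumes convex: "convex_on UNIV f" and diff: "\<And>x. f differentiable (at x)"
    and lip: "L-lipschitz_on UNIV (grad f)"
    and \<gamma>: "0 < \<gamma>" and \<gamma>L: "\<gamma> * L < 1" and x: "p + \<gamma> *\<^sub>R grad f p = x"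
  shows "grad_moreau_env \<gamma> (\<lambda>x. ereal (f x)) x = grad f p"
proof -
  define e where "e = (\<lambda>x. real_of_ereal (moreau_env \<gamma> (\<lambda>x. ereal (f x)) x))"
  define v where "v = grad f p"
  have e: "e (q + \<gamma> *\<^sub>R grad f q) = f q + \<gamma> / 2 * (norm (grad f q))\<^sup>2" for q
    using moreau_env_eq[OF convex diff \<gamma> refl] by (simp add: e_def)
  have quot: "norm (e y - e x - inner (y - x) v) / norm (y - x) \<le> 1 / (2 * \<gamma>) * norm (y - x)" for y
  proof -
    define d where "d = y - x"
    obtain q where q: "q + \<gamma> *\<^sub>R grad f q = y"
      using forward_step_surjective[OF lip _ \<gamma>L] \<gamma> by (metis less_imp_le)
    have ex: "e x = f p + \<gamma> / 2 * (norm v)\<^sup>2"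
      using e[of p] by (simp add: x v_def)
    have "e y \<le> f p + 1 / (2 * \<gamma>) * (norm (p - y))\<^sup>2"
    proof -
      have "0 \<le> 1 / (2 * \<gamma>) * (norm (p - q))\<^sup>2" using \<gamma> by simp
      moreover have "1 / (2 * \<gamma>) * (norm (q - y))\<^sup>2 = \<gamma> / 2 * (norm (grad f q))\<^sup>2"
        using \<gamma> by (simp add: q[symmetric] power_mult_distrib power2_eq_square)
      ultimately show ?thesis
        using e[of q, unfolded q] prox_objective_growth[OF convex diff \<gamma> q, of p] by linarith
    qed
    also have "p - y = - (\<gamma> *\<^sub>R v + d)"
      using x by (simp add: d_def v_def algebra_simps)
    also have "f p + 1 / (2 * \<gamma>) * (norm (- (\<gamma> *\<^sub>R v + d)))\<^sup>2
        = e x + inner d v + 1 / (2 * \<gamma>) * (norm d)\<^sup>2"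
      using \<gamma> unfolding ex norm_minus_cancel power2_norm_eq_inner
      by (simp add: inner_add inner_commute field_simps)
    finally have upper: "e y \<le> e x + inner d v + 1 / (2 * \<gamma>) * (norm d)\<^sup>2" .
    have lower: "e x + inner d v \<le> e y"
    proof -
      have s: "q - p = d + \<gamma> *\<^sub>R v - \<gamma> *\<^sub>R grad f q"
        using x q by (simp add: d_def v_def algebra_simps)
      have "f p + inner v (q - p) \<le> f q"
        unfolding v_def by (rule convex_above_tangent_plane[OF convex diff])
      \<comment> \<open>Completing the square; the last term on the right is the slack in the bound.\<close>
      moreover have "inner v (q - p) + \<gamma> / 2 * (norm (grad f q))\<^sup>2
          = \<gamma> / 2 * (norm v)\<^sup>2 + inner d v + \<gamma> / 2 * (norm (v - grad f q))\<^sup>2"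
        unfolding s power2_norm_eq_inner
        by (simp add: inner_add inner_diff inner_commute field_simps)
      moreover have "0 \<le> \<gamma> / 2 * (norm (v - grad f q))\<^sup>2"
        using \<gamma> by simp
      ultimately show ?thesis
        using e[of q] by (simp add: ex q)
    qed
    have "norm (e y - e x - inner d v) \<le> 1 / (2 * \<gamma>) * (norm d)\<^sup>2"
      using upper lower by simp
    then show ?thesis
      unfolding d_def[symmetric] by (cases "d = 0") (simp_all add: field_simps power2_eq_square)
  qed
  have "(e has_derivative (\<lambda>h. inner h v)) (at x)"
  proof (rule has_derivativeI_sandwich[of 1])
    show "((\<lambda>y. 1 / (2 * \<gamma>) * norm (y - x)) \<longlongrightarrow> 0) (at x)"
      using \<gamma> by (auto intro!: tendsto_eq_intros)
  qed (use quot in \<open>auto intro: bounded_linear_inner_left\<close>)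
  then have "grad e x = v"
    by (intro grad_eqI) (simp add: gderiv_def)
  then show ?thesis
    by (simp add: grad_moreau_env_def e_def v_def)
qed

section \<open>The forward-backward envelope\<close>

text \<open>The linearization of \<open>f\<close> at \<open>p\<close> and the quadratic term are kept apart instead of being
  merged into a Moreau envelope of \<open>g\<close>; this is the form that the descent lemma bounds from below.\<close>

definition FB_env ::
  "real \<Rightarrow> ('a::euclidean_space \<Rightarrow> real) \<Rightarrow> ('a \<Rightarrow> ereal) \<Rightarrow> 'a \<Rightarrow> ereal" where
  "FB_env \<gamma> f g p =
     (INF z. ereal (f p + inner (grad f p) (z - p) + 1 / (2 * \<gamma>) * (norm (z - p))\<^sup>2) + g z)"

lemma INF_add_ereal_const:
  fixes h :: "'b \<Rightarrow> ereal"
  shows "ereal c + (INF i. h i) = (INF i. ereal c + h i)"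
proof (rule antisym)
  show "ereal c + (INF i. h i) \<le> (INF i. ereal c + h i)"
    by (intro INF_greatest add_left_mono INF_lower) simp
  have "(INF i. ereal c + h i) - ereal c \<le> h i" for i
    by (subst ereal_minus_le) (auto intro: INF_lower simp: add.commute)
  then have "(INF i. ereal c + h i) - ereal c \<le> (INF i. h i)"
    by (intro INF_greatest)
  then show "(INF i. ereal c + h i) \<le> ereal c + (INF i. h i)"
    by (subst (asm) ereal_minus_le) (auto simp: add.commute)
qed

text \<open>With \<open>v = grad f p\<close>, the two envelopes of \<open>f\<close> and \<open>g\<close> are centred at \<open>p + \<gamma> *\<^sub>R v\<close> and its
  reflection \<open>p - \<gamma> *\<^sub>R v\<close>. Expanding the square about the latter yields an extra \<open>\<gamma> / 2 * (norm v)\<^sup>2\<close>.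
  The envelope of \<open>f\<close> contributes the same amount, and the correction \<open>\<gamma> * (norm v)\<^sup>2\<close> in the
  Douglas-Rachford envelope cancels both.\<close>

lemma DR_env_eq_FB_env:
  fixes f :: "'a::euclidean_space \<Rightarrow> real"
  assumes convex: "convex_on UNIV f" and diff: "\<And>x. f differentiable (at x)"
    and lip: "L-lipschitz_on UNIV (grad f)"
    and \<gamma>: "0 < \<gamma>" and \<gamma>L: "\<gamma> * L < 1" and x: "p + \<gamma> *\<^sub>R grad f p = x"
  shows "DR_env \<gamma> (\<lambda>x. ereal (f x)) g x = FB_env \<gamma> f g p"
proof -
  define v where "v = grad f p"
  have "x - (2 * \<gamma>) *\<^sub>R v = p - \<gamma> *\<^sub>R v"
    by (simp add: x[symmetric] v_def algebra_simps flip: scaleR_add_left)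
  then have "DR_env \<gamma> (\<lambda>x. ereal (f x)) g x
      = ereal (f p - \<gamma> / 2 * (norm v)\<^sup>2) + moreau_env \<gamma> g (p - \<gamma> *\<^sub>R v)"
    unfolding DR_env_def grad_moreau_env_eq[OF convex diff lip \<gamma> \<gamma>L x]
      moreau_env_eq[OF convex diff \<gamma> x] v_def[symmetric]
    by simp
  also have "\<dots> = (INF z. ereal (f p - \<gamma> / 2 * (norm v)\<^sup>2)
      + prox_objective \<gamma> g (p - \<gamma> *\<^sub>R v) z)"
    unfolding moreau_env_def by (rule INF_add_ereal_const)
  also have "\<dots> = FB_env \<gamma> f g p"
    unfolding FB_env_def
  proof (rule INF_cong[OF refl])
    fix z
    have "z - (p - \<gamma> *\<^sub>R v) = (z - p) + \<gamma> *\<^sub>R v"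
      by simp
    then have "f p - \<gamma> / 2 * (norm v)\<^sup>2 + 1 / (2 * \<gamma>) * (norm (z - (p - \<gamma> *\<^sub>R v)))\<^sup>2
        = f p + inner v (z - p) + 1 / (2 * \<gamma>) * (norm (z - p))\<^sup>2"
      using \<gamma> unfolding power2_norm_eq_inner
      by (simp only: inner_add_left inner_add_right inner_scaleR_left inner_scaleR_right)
        (simp add: inner_commute field_simps)
    then show "ereal (f p - \<gamma> / 2 * (norm v)\<^sup>2) + prox_objective \<gamma> g (p - \<gamma> *\<^sub>R v) z
        = ereal (f p + inner (grad f p) (z - p) + 1 / (2 * \<gamma>) * (norm (z - p))\<^sup>2) + g z"
      unfolding prox_objective_def v_def[symmetric]
      by (cases "g z") simp_all
  qed
  finally show ?thesis .
qed

lemma FB_env_le: "FB_env \<gamma> f g p \<le> ereal (f p) + g p"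
  unfolding FB_env_def by (rule INF_lower2[of p]) simp_all

context
  fixes f :: "'a::euclidean_space \<Rightarrow> real" and g :: "'a \<Rightarrow> ereal" and L \<gamma> :: real
  assumes diff: "\<And>x. f differentiable (at x)" and lip: "L-lipschitz_on UNIV (grad f)"
    and \<gamma>: "0 < \<gamma>" and \<gamma>L: "\<gamma> * L < 1"
begin

text \<open>Majorizing \<open>f\<close> by the descent lemma consumes only \<open>L / 2\<close> of the quadratic coefficient
  \<open>1 / (2 * \<gamma>)\<close>; the surplus remains as a penalty for leaving \<open>p\<close>.\<close>

lemma FB_env_ge_INF_penalized:
  "(INF z. ereal (f z + (1 / (2 * \<gamma>) - L / 2) * (norm (z - p))\<^sup>2) + g z) \<le> FB_env \<gamma> f g p"
  unfolding FB_env_def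
proof (rule INF_mono)
  fix z
  show "\<exists>y\<in>UNIV. ereal (f y + (1 / (2 * \<gamma>) - L / 2) * (norm (y - p))\<^sup>2) + g y
    \<le> ereal (f p + inner (grad f p) (z - p) + 1 / (2 * \<gamma>) * (norm (z - p))\<^sup>2) + g z"
    using descent_lemma[OF diff lip, of z p]
    by (intro bexI[of _ z] add_right_mono) (auto simp: algebra_simps)
qed

lemma penalty_pos: "0 < 1 / (2 * \<gamma>) - L / 2"
  using \<gamma> \<gamma>L by (simp add: field_simps)

lemma INF_FB_env: "(INF p. FB_env \<gamma> f g p) = (INF x. ereal (f x) + g x)"
proof (rule antisym)
  show "(INF p. FB_env \<gamma> f g p) \<le> (INF x. ereal (f x) + g x)"
    by (rule INF_mono) (use FB_env_le in blast)
  have "(INF x. ereal (f x) + g x)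
      \<le> (INF z. ereal (f z + (1 / (2 * \<gamma>) - L / 2) * (norm (z - p))\<^sup>2) + g z)" for p
    using penalty_pos by (intro INF_mono) (auto intro!: add_right_mono exI)
  then show "(INF x. ereal (f x) + g x) \<le> (INF p. FB_env \<gamma> f g p)"
    by (intro INF_greatest) (use FB_env_ge_INF_penalized order_trans in blast)
qed

text \<open>When \<open>m\<close> is a lower bound of \<open>f + g\<close>, the penalized values can come within \<open>1 / (k + 1)\<close> of \<open>m\<close>
  only at points whose squared distance to \<open>p\<close> is at most \<open>1 / (k + 1)\<close> divided by the penalty
  coefficient. A sequence of such points converges to \<open>p\<close>, and the inequality for \<open>g\<close> passes to the
  limit because the epigraph of \<open>g\<close> is closed.\<close>

lemma FB_env_le_imp_le:
  assumes closed: "closed_fun g" and m: "\<And>x. ereal m \<le> ereal (f x) + g x"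
    and p: "FB_env \<gamma> f g p \<le> ereal m"
  shows "ereal (f p) + g p \<le> ereal m"
proof -
  define c where "c = 1 / (2 * \<gamma>) - L / 2"
  have c: "0 < c"
    using penalty_pos by (simp add: c_def)
  have "\<exists>z. ereal (f z + c * (norm (z - p))\<^sup>2) + g z < ereal (m + inverse (real (Suc k)))" for k
  proof -
    have "(INF z. ereal (f z + c * (norm (z - p))\<^sup>2) + g z) \<le> ereal m"
      using FB_env_ge_INF_penalized p unfolding c_def by (rule order_trans)
    also have "\<dots> < ereal (m + inverse (real (Suc k)))"
      by simp
    finally show ?thesis
      by (simp add: INF_less_iff)
  qed
  then obtain z where z: "\<And>k. ereal (f (z k) + c * (norm (z k - p))\<^sup>2) + g (z k)
      < ereal (m + inverse (real (Suc k)))"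
    by metis
  have g_le: "g (z k) \<le> ereal (m + inverse (real (Suc k)) - f (z k))"
    and dist_le: "c * (norm (z k - p))\<^sup>2 \<le> inverse (real (Suc k))" for k
  proof -
    have "0 \<le> c * (norm (z k - p))\<^sup>2"
      using c by simp
    then show "g (z k) \<le> ereal (m + inverse (real (Suc k)) - f (z k))"
      and "c * (norm (z k - p))\<^sup>2 \<le> inverse (real (Suc k))"
      using z[of k] m[of "z k"] by (cases "g (z k)"; simp)+
  qed
  have "(\<lambda>k. (norm (z k - p))\<^sup>2) \<longlonglongrightarrow> 0"
  proof (rule tendsto_sandwich[OF _ _ tendsto_const])
    show "(\<lambda>k. inverse (real (Suc k)) / c) \<longlonglongrightarrow> 0"
      using tendsto_divide[OF LIMSEQ_inverse_real_of_nat tendsto_const[of c]] c by simp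
    show "\<forall>\<^sub>F k in sequentially. (norm (z k - p))\<^sup>2 \<le> inverse (real (Suc k)) / c"
      using dist_le c by (auto intro!: always_eventually simp: pos_le_divide_eq mult.commute)
  qed simp
  then have "(\<lambda>k. norm (z k - p)) \<longlonglongrightarrow> 0"
    using tendsto_real_sqrt[of "\<lambda>k. (norm (z k - p))\<^sup>2" 0] by simp
  then have z_lim: "z \<longlonglongrightarrow> p"
    by (simp add: tendsto_norm_zero_iff LIM_zero_iff)
  have "isCont f p"
    using diff differentiable_imp_continuous_within by blast
  then have "(\<lambda>k. f (z k)) \<longlonglongrightarrow> f p"
    using z_lim by (rule isCont_tendsto_compose)
  then have "(\<lambda>k. (z k, m + inverse (real (Suc k)) - f (z k))) \<longlonglongrightarrow> (p, m + 0 - f p)"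
    by (intro tendsto_Pair tendsto_diff tendsto_add tendsto_const z_lim LIMSEQ_inverse_real_of_nat)
  then have lim: "(\<lambda>k. (z k, m + inverse (real (Suc k)) - f (z k))) \<longlonglongrightarrow> (p, m - f p)"
    by simp
  have "(p, m - f p) \<in> epi g"
  proof (rule closed_sequentially[OF _ _ lim])
    show "closed (epi g)"
      using closed by (simp add: closed_fun_def)
    show "(z k, m + inverse (real (Suc k)) - f (z k)) \<in> epi g" for k
      using g_le by (simp add: epi_def)
  qed
  then have "g p \<le> ereal (m - f p)"
    by (simp add: epi_def)
  then show ?thesis
    by (cases "g p") simp_all
qed

lemma argmin_FB_env:
  assumes closed: "closed_fun g" and proper: "proper_fun g"
    and ne: "argmin_set (\<lambda>x. ereal (f x) + g x) \<noteq> {}"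
  shows "argmin_set (FB_env \<gamma> f g) = argmin_set (\<lambda>x. ereal (f x) + g x)"
proof -
  let ?F = "\<lambda>x. ereal (f x) + g x"
  obtain w where w: "\<And>x. ?F w \<le> ?F x"
    using ne by (auto simp: argmin_set_def is_arg_min_linorder)
  \<comment> \<open>The minimum is a real number: \<open>g\<close> is finite somewhere and never \<open>-\<infinity>\<close>.\<close>
  obtain a where "g a \<noteq> \<infinity>" "g w \<noteq> -\<infinity>"
    using proper by (auto simp: proper_fun_def)
  with w[of a] obtain m where m: "?F w = ereal m"
    by (cases "g w"; cases "g a") auto
  have "(INF x. ?F x) = ereal m"
    unfolding m[symmetric] using w by (intro INF_eqI) auto
  then have "(INF p. FB_env \<gamma> f g p) = ereal m"
    by (simp add: INF_FB_env)
  then have lower: "ereal m \<le> FB_env \<gamma> f g p" for p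
    by (metis INF_lower UNIV_I)
  have attained: "FB_env \<gamma> f g w \<le> ereal m"
    using FB_env_le[of \<gamma> f g w] by (simp add: m)
  have "p \<in> argmin_set (FB_env \<gamma> f g) \<longleftrightarrow> FB_env \<gamma> f g p \<le> ereal m" for p
    using lower attained order_trans by (fastforce simp: argmin_set_def is_arg_min_linorder)
  moreover have "FB_env \<gamma> f g p \<le> ereal m \<longleftrightarrow> ?F p \<le> ereal m" for p
    using FB_env_le_imp_le[OF closed] w FB_env_le order_trans unfolding m by metis
  moreover have "p \<in> argmin_set ?F \<longleftrightarrow> ?F p \<le> ereal m" for p
    using w order_trans unfolding m[symmetric]
    by (fastforce simp: argmin_set_def is_arg_min_linorder)
  ultimately show ?thesis
    by blast
qed

end

section \<open>Minimizers of the Douglas-Rachford envelope\<close>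

theorem theorem1:
  fixes f :: "real ^ 'n \<Rightarrow> real" and g F :: "real ^ 'n \<Rightarrow> ereal" and L \<gamma> :: real
  assumes "convex_on UNIV f"
    and "twice_continuously_differentiable f"
    and "L-lipschitz_on UNIV (grad f)"
    and "proper_fun g" and "closed_fun g" and "convex_fun g"
    and F: "\<And>x. F x = ereal (f x) + g x"
    and "argmin_set F \<noteq> {}"
    and "0 < \<gamma>" and "L \<noteq> 0 \<Longrightarrow> \<gamma> < 1 / L"
  shows "(INF x. F x) = (INF x. DR_env \<gamma> (\<lambda>x. ereal (f x)) g x) \<and>
    argmin_set F = prox \<gamma> (\<lambda>x. ereal (f x)) ` argmin_set (DR_env \<gamma> (\<lambda>x. ereal (f x)) g)"
proof -
  let ?f = "\<lambda>x. ereal (f x)"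
  let ?P = "prox \<gamma> ?f" and ?DR = "DR_env \<gamma> ?f g"
  have F_eq: "F = (\<lambda>x. ereal (f x) + g x)"
    using F by blast
  have diff: "f differentiable (at x)" for x
    using assms(2) by (simp add: twice_continuously_differentiable_def)
  have \<gamma>L: "\<gamma> * L < 1"
    using assms(9,10) lipschitz_on_nonneg[OF assms(3)] by (cases "L = 0") (auto simp: field_simps)
  have step: "?P (p + \<gamma> *\<^sub>R grad f p) = p" for p
    by (rule prox_eq[OF assms(1) diff assms(9) refl])
  have surj: "surj ?P"
    using step by (rule surjI)
  have DR: "?DR = (\<lambda>x. FB_env \<gamma> f g (?P x))"
  proof
    fix x
    obtain p where p: "p + \<gamma> *\<^sub>R grad f p = x"
      using forward_step_surjective[OF assms(3) _ \<gamma>L] assms(9) by (metis less_imp_le)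
    show "?DR x = FB_env \<gamma> f g (?P x)"
      using DR_env_eq_FB_env[OF assms(1) diff assms(3,9) \<gamma>L p] step[of p] by (simp add: p)
  qed
  have "range ?DR = range (FB_env \<gamma> f g)"
    unfolding DR using surj by (metis image_image)
  then have "(INF x. ?DR x) = (INF x. F x)"
    using INF_FB_env[OF diff assms(3,9) \<gamma>L] by (simp add: F_eq)
  moreover have "?P ` argmin_set ?DR = argmin_set (FB_env \<gamma> f g)"
  proof -
    have "x \<in> argmin_set ?DR \<longleftrightarrow> ?P x \<in> argmin_set (FB_env \<gamma> f g)" for x
      unfolding DR argmin_set_def is_arg_min_linorder using surj by (simp, metis surjD)
    then have "argmin_set ?DR = ?P -` argmin_set (FB_env \<gamma> f g)"
      by blast
    then show ?thesis
      using surj by (simp add: surj_image_vimage_eq)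
  qed
  moreover have "argmin_set (FB_env \<gamma> f g) = argmin_set F"
    using argmin_FB_env[OF diff assms(3,9) \<gamma>L assms(5,4)] assms(8) by (simp add: F_eq)
  ultimately show ?thesis
    by simp
qed

end
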